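(* Suppose that the Regularity assumption and the Parameter assumption of the context hold, and let $N\ge2$. For $k\ge1$ let $$\Phi_k:=\mathcal L_\rho(x_k,\lambda_k)+\frac{C_{\lambda,p}}{\rho}\|p_{k-1}\|^2 .$$ If the NR-LALM iterates remain in the regularity region up to iteration $N$ (i.e. $[x_k,x_{k+1}]\subset\mathcal U$ for $0\le k\le N-1$), then $$\Phi_{k+1}\le\Phi_k-\frac{\beta}{4}\|p_k\|^2\qquad\text{for }1\le k\le N-1 .$$ Moreover, $$\Phi_k\ge\underline\Phi:=\underline f-\frac{\Lambda^2}{2\rho}\qquad\text{for }1\le k\le N .$$
   Context: Norms are Euclidean for vectors and spectral for matrices; for $f:\mathbb R^n\to\mathbb R$, $c:\mathbb R^n\to\mathbb R^m$, $\nabla c(x):=(\nabla c_1(x),\ldots,\nabla c_m(x))\in\mathbb R^{n\times m}$. The augmented Lagrangian is $\mathcal L_\rho(x,\lambda):=f(x)+\langle\lambda,c(x)\rangle+\frac{\rho}{2}\|c(x)\|^2$. Regularity assumption: $f$ and $c$ are continuously differentiable on a nonempty open set $\mathcal U\subseteq\mathbb R^n$, and there are $\underline f\in\mathbb R$ and positive constants $G,L_f,M,L_c,\sigma$ such that for all $x,y\in\mathcal U$ and $u\in\mathbb R^m$: (i) $f(x)\ge\underline f$, $\|\nabla f(x)\|\le G$, $\|\nabla f(x)-\nabla f(y)\|\le L_f\|x-y\|$; (ii) $\|\nabla c(x)\|\le M$, $\|\nabla c(x)-\nabla c(y)\|\le L_c\|x-y\|$; (iii) $\|\nabla c(x)u\|\ge\sigma\|u\|$.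 Constants: $\kappa_{\mathrm{lin}}:=L_c/2$ and, for $\beta,\rho,\Delta,\Lambda>0$, $$C_{\mathrm{mod}}:=\frac{L_f}{2}+\kappa_{\mathrm{lin}}(3\Lambda+\rho M\Delta)+\frac{\rho}{2}\kappa_{\mathrm{lin}}^2\Delta^2,\quad A_p:=\beta+\rho M\kappa_{\mathrm{lin}}\Delta,\quad B_p:=A_p+L_f+L_c\Lambda,\quad C_{\lambda,p}:=\frac{4}{\sigma^2}\max\{A_p^2,B_p^2\}.$$ Parameter assumption: the fixed constants $\beta,\rho,\Delta,\Lambda>0$ satisfy $$\Lambda\ge\frac{G+\beta\Delta+\rho M\kappa_{\mathrm{lin}}\Delta^2}{\sigma},\quad \frac{G}{\beta}+\frac{3M\Lambda}{\beta+\rho\sigma^2}\le\Delta,\quad C_{\mathrm{mod}}\le\frac{3\beta}{8},\quad \rho\ge\frac{8C_{\lambda,p}}{\beta},$$ and the initial pair satisfies $\|\lambda_0\|\le\Lambda$ and $\rho\|c(x_0)\|\le\Lambda$. NR-LALM (deterministic): from $(x_0,\lambda_0)\in\mathbb R^n\times\mathbb R^m$, for $k=0,1,2,\ldots$, $p_k$ is the solution of $$(\beta I_n+\rho\nabla c(x_k)\nabla c(x_k)^\top)p_k=-\nabla f(x_k)-\nabla c(x_k)(\lambda_k+\rho c(x_k)),$$ and $x_{k+1}=x_k+p_k$, $\lambda_{k+1}=\lambda_k+\rho c(x_{k+1})$. *)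

theory Defs
  imports "HOL-Analysis.Analysis"
begin

definition grad :: "(real ^ 'n \<Rightarrow> real) \<Rightarrow> real ^ 'n \<Rightarrow> real ^ 'n" where
  "grad f x = (THE g. GDERIV f x :> g)"

text \<open>The gradients of the components of \<open>c\<close> are the \<^emph>\<open>columns\<close> of the \<open>n \<times> m\<close> matrix
  \<open>nabla c x\<close>; this is the transpose of the Jacobian.\<close>

definition nabla :: "(real ^ 'n \<Rightarrow> real ^ 'm) \<Rightarrow> real ^ 'n \<Rightarrow> real ^ 'm ^ 'n" where
  "nabla c x = (\<chi> i j. grad (\<lambda>y. c y $ j) x $ i)"

text \<open>The type-class \<^const>\<open>norm\<close> on matrices is the Frobenius norm, so the spectral norm is
  introduced separately.\<close>

definition spectral_norm :: "real ^ 'm ^ 'n \<Rightarrow> real" where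
  "spectral_norm A = onorm (\<lambda>u. A *v u)"

definition aug_lagrangian ::
  "(real ^ 'n \<Rightarrow> real) \<Rightarrow> (real ^ 'n \<Rightarrow> real ^ 'm) \<Rightarrow> real \<Rightarrow> real ^ 'n \<Rightarrow> real ^ 'm \<Rightarrow> real" where
  "aug_lagrangian f c \<rho> x l = f x + l \<bullet> c x + \<rho> / 2 * (norm (c x))\<^sup>2"

definition regularity ::
  "(real ^ 'n \<Rightarrow> real) \<Rightarrow> (real ^ 'n \<Rightarrow> real ^ 'm) \<Rightarrow> (real ^ 'n) set \<Rightarrow>
    real \<Rightarrow> real \<Rightarrow> real \<Rightarrow> real \<Rightarrow> real \<Rightarrow> real \<Rightarrow> bool" where
  "regularity f c U f_low G L\<^sub>f M L\<^sub>c \<sigma> \<longleftrightarrow>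
     open U \<and> U \<noteq> {} \<and>
     (\<forall>x\<in>U. f differentiable (at x)) \<and> continuous_on U (grad f) \<and>
     (\<forall>x\<in>U. c differentiable (at x)) \<and> continuous_on U (nabla c) \<and>
     G > 0 \<and> L\<^sub>f > 0 \<and> M > 0 \<and> L\<^sub>c > 0 \<and> \<sigma> > 0 \<and>
     (\<forall>x\<in>U. f x \<ge> f_low) \<and>
     (\<forall>x\<in>U. norm (grad f x) \<le> G) \<and>
     (\<forall>x\<in>U. \<forall>y\<in>U. norm (grad f x - grad f y) \<le> L\<^sub>f * norm (x - y)) \<and>
     (\<forall>x\<in>U. spectral_norm (nabla c x) \<le> M) \<and>
     (\<forall>x\<in>U. \<forall>y\<in>U. spectral_norm (nabla c x - nabla c y) \<le> L\<^sub>c * norm (x - y)) \<and>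
     (\<forall>x\<in>U. \<forall>u. norm (nabla c x *v u) \<ge> \<sigma> * norm u)"

definition kappa_lin :: "real \<Rightarrow> real" where
  "kappa_lin L\<^sub>c = L\<^sub>c / 2"

definition C_mod :: "real \<Rightarrow> real \<Rightarrow> real \<Rightarrow> real \<Rightarrow> real \<Rightarrow> real \<Rightarrow> real" where
  "C_mod L\<^sub>f M L\<^sub>c \<rho> \<Delta> \<Lambda> =
     L\<^sub>f / 2 + kappa_lin L\<^sub>c * (3 * \<Lambda> + \<rho> * M * \<Delta>) + \<rho> / 2 * (kappa_lin L\<^sub>c)\<^sup>2 * \<Delta>\<^sup>2"

definition A_p :: "real \<Rightarrow> real \<Rightarrow> real \<Rightarrow> real \<Rightarrow> real \<Rightarrow> real" where
  "A_p M L\<^sub>c \<beta> \<rho> \<Delta> = \<beta> + \<rho> * M * kappa_lin L\<^sub>c * \<Delta>"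

definition B_p :: "real \<Rightarrow> real \<Rightarrow> real \<Rightarrow> real \<Rightarrow> real \<Rightarrow> real \<Rightarrow> real \<Rightarrow> real" where
  "B_p L\<^sub>f M L\<^sub>c \<beta> \<rho> \<Delta> \<Lambda> = A_p M L\<^sub>c \<beta> \<rho> \<Delta> + L\<^sub>f + L\<^sub>c * \<Lambda>"

definition C_lambda_p ::
  "real \<Rightarrow> real \<Rightarrow> real \<Rightarrow> real \<Rightarrow> real \<Rightarrow> real \<Rightarrow> real \<Rightarrow> real \<Rightarrow> real" where
  "C_lambda_p L\<^sub>f M L\<^sub>c \<sigma> \<beta> \<rho> \<Delta> \<Lambda> =
     4 / \<sigma>\<^sup>2 * max ((A_p M L\<^sub>c \<beta> \<rho> \<Delta>)\<^sup>2) ((B_p L\<^sub>f M L\<^sub>c \<beta> \<rho> \<Delta> \<Lambda>)\<^sup>2)"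

definition parameter_conditions ::
  "real \<Rightarrow> real \<Rightarrow> real \<Rightarrow> real \<Rightarrow> real \<Rightarrow> real \<Rightarrow> real \<Rightarrow> real \<Rightarrow> real \<Rightarrow> bool" where
  "parameter_conditions G L\<^sub>f M L\<^sub>c \<sigma> \<beta> \<rho> \<Delta> \<Lambda> \<longleftrightarrow>
     \<beta> > 0 \<and> \<rho> > 0 \<and> \<Delta> > 0 \<and> \<Lambda> > 0 \<and>
     \<Lambda> \<ge> (G + \<beta> * \<Delta> + \<rho> * M * kappa_lin L\<^sub>c * \<Delta>\<^sup>2) / \<sigma> \<and>
     G / \<beta> + 3 * M * \<Lambda> / (\<beta> + \<rho> * \<sigma>\<^sup>2) \<le> \<Delta> \<and>
     C_mod L\<^sub>f M L\<^sub>c \<rho> \<Delta> \<Lambda> \<le> 3 * \<beta> / 8 \<and>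
     \<rho> \<ge> 8 * C_lambda_p L\<^sub>f M L\<^sub>c \<sigma> \<beta> \<rho> \<Delta> \<Lambda> / \<beta>"

definition initial_conditions ::
  "(real ^ 'n \<Rightarrow> real ^ 'm) \<Rightarrow> real \<Rightarrow> real \<Rightarrow> real ^ 'n \<Rightarrow> real ^ 'm \<Rightarrow> bool" where
  "initial_conditions c \<rho> \<Lambda> x\<^sub>0 l\<^sub>0 \<longleftrightarrow> norm l\<^sub>0 \<le> \<Lambda> \<and> \<rho> * norm (c x\<^sub>0) \<le> \<Lambda>"

definition nr_lalm_step ::
  "(real ^ 'n \<Rightarrow> real) \<Rightarrow> (real ^ 'n \<Rightarrow> real ^ 'm) \<Rightarrow> real \<Rightarrow> real \<Rightarrow>
    real ^ 'n \<Rightarrow> real ^ 'm \<Rightarrow> real ^ 'n \<Rightarrow> real ^ 'n \<Rightarrow> real ^ 'm \<Rightarrow> bool" where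
  "nr_lalm_step f c \<beta> \<rho> x l p x' l' \<longleftrightarrow>
     (\<beta> *\<^sub>R mat 1 + \<rho> *\<^sub>R (nabla c x ** transpose (nabla c x))) *v p
       = - grad f x - nabla c x *v (l + \<rho> *\<^sub>R c x) \<and>
     x' = x + p \<and>
     l' = l + \<rho> *\<^sub>R c x'"

text \<open>Only the first \<open>N\<close> steps are constrained: beyond the regularity region the gradients need
  not exist, so the algorithm need not be able to continue. For positive \<open>\<beta>\<close> and \<open>\<rho>\<close> the matrix of
  the linear system is positive definite, so the equation determines \<open>p k\<close> uniquely.\<close>

definition nr_lalm_iterates ::
  "(real ^ 'n \<Rightarrow> real) \<Rightarrow> (real ^ 'n \<Rightarrow> real ^ 'm) \<Rightarrow> real \<Rightarrow> real \<Rightarrow> nat \<Rightarrow>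
    (nat \<Rightarrow> real ^ 'n) \<Rightarrow> (nat \<Rightarrow> real ^ 'm) \<Rightarrow> (nat \<Rightarrow> real ^ 'n) \<Rightarrow> bool" where
  "nr_lalm_iterates f c \<beta> \<rho> N x l p \<longleftrightarrow>
     (\<forall>k<N. nr_lalm_step f c \<beta> \<rho> (x k) (l k) (p k) (x (Suc k)) (l (Suc k)))"

text \<open>\<open>C\<close> stands for the constant \<^const>\<open>C_lambda_p\<close>; only meaningful for \<open>k \<ge> 1\<close>.\<close>

definition potential ::
  "(real ^ 'n \<Rightarrow> real) \<Rightarrow> (real ^ 'n \<Rightarrow> real ^ 'm) \<Rightarrow> real \<Rightarrow> real \<Rightarrow>
    (nat \<Rightarrow> real ^ 'n) \<Rightarrow> (nat \<Rightarrow> real ^ 'm) \<Rightarrow> (nat \<Rightarrow> real ^ 'n) \<Rightarrow> nat \<Rightarrow> real" where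
  "potential f c \<rho> C x l p k =
     aug_lagrangian f c \<rho> (x k) (l k) + C / \<rho> * (norm (p (k - 1)))\<^sup>2"

end

theory Submission
  imports Defs
begin

text \<open>
  Write \<open>r\<^sub>k\<close> for the linearization error of \<open>c\<close> along the \<open>k\<close>-th step, so
  \<open>\<parallel>r\<^sub>k\<parallel> \<le> \<kappa>\<^sub>l\<^sub>i\<^sub>n \<parallel>p\<^sub>k\<parallel>\<^sup>2\<close>. The step equation becomes
  \<open>\<nabla>c(x\<^sub>k) \<lambda>\<^sub>k\<^sub>+\<^sub>1 = \<rho> \<nabla>c(x\<^sub>k) r\<^sub>k - \<nabla>f(x\<^sub>k) - \<beta> p\<^sub>k\<close>. Since \<open>\<nabla>c(x\<^sub>k)\<close> is bounded below by
  \<open>\<sigma>\<close>, this yields inductively \<open>\<parallel>\<lambda>\<^sub>k\<parallel> \<le> \<Lambda>\<close> (hence \<open>\<rho> \<parallel>c(x\<^sub>k)\<parallel> \<le> 2\<Lambda>\<close> and \<open>\<parallel>p\<^sub>k\<parallel> \<le> \<Delta>\<close>), and,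
  by subtracting two consecutive equations,
  \<open>\<parallel>\<lambda>\<^sub>k\<^sub>+\<^sub>1 - \<lambda>\<^sub>k\<parallel>\<^sup>2 \<le> C\<^sub>\<lambda>\<^sub>,\<^sub>p/2 (\<parallel>p\<^sub>k\<parallel>\<^sup>2 + \<parallel>p\<^sub>k\<^sub>-\<^sub>1\<parallel>\<^sup>2)\<close>. The primal step decreases the augmented
  Lagrangian by at least \<open>(\<beta> - C\<^sub>m\<^sub>o\<^sub>d) \<parallel>p\<^sub>k\<parallel>\<^sup>2 \<ge> 5\<beta>/8 \<parallel>p\<^sub>k\<parallel>\<^sup>2\<close>, the dual step increases it by
  exactly \<open>\<parallel>\<lambda>\<^sub>k\<^sub>+\<^sub>1 - \<lambda>\<^sub>k\<parallel>\<^sup>2/\<rho>\<close>, and \<open>C\<^sub>\<lambda>\<^sub>,\<^sub>p/\<rho> \<le> \<beta>/8\<close> lets the extra term of the potential absorb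
  the latter. The lower bound comes from completing the square in \<open>\<lambda>\<^sub>k + \<rho> c(x\<^sub>k)\<close>.
\<close>

section \<open>Quadratic remainders and gradients as derivatives\<close>

text \<open>Serves both the real-valued \<open>f\<close> and the vector-valued \<open>c\<close>. The
  Lipschitz bound is asked only in direction \<open>h\<close> and relative to the base point
  \<open>x\<close>.\<close>

lemma quadratic_remainder_bound:
  fixes F :: "'a::real_inner \<Rightarrow> 'b::real_inner"
  assumes "convex S" "x \<in> S" "x + h \<in> S"
    and deriv: "\<And>y. y \<in> S \<Longrightarrow> (F has_derivative F' y) (at y)"
    and lip: "\<And>y. y \<in> S \<Longrightarrow> norm (F' y h - F' x h) \<le> L * norm (y - x) * norm h"
  shows "norm (F (x + h) - F x - F' x h) \<le> L / 2 * (norm h)\<^sup>2"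
proof -
  define v where "v = F (x + h) - F x - F' x h"
  define K where "K = norm v * L * (norm h)\<^sup>2"
  \<comment> \<open>Pairing with the remainder itself reduces the vector-valued bound to a monotone real function.\<close>
  define \<psi> where "\<psi> t = v \<bullet> F (x + t *\<^sub>R h) - t * (v \<bullet> F' x h) - K / 2 * t\<^sup>2" for t
  have "\<psi> 1 \<le> \<psi> 0"
  proof (rule DERIV_nonpos_imp_nonincreasing[of 0 1 \<psi>])
    fix t :: real
    assume t: "0 \<le> t" "t \<le> 1"
    let ?y = "x + t *\<^sub>R h"
    have "?y = (1 - t) *\<^sub>R x + t *\<^sub>R (x + h)"
      by (simp add: algebra_simps)
    then have y: "?y \<in> S"
      using convexD[OF assms(1-3), of "1 - t" t] t by simp
    have "((\<lambda>t. F (x + t *\<^sub>R h)) has_derivative (\<lambda>s. F' ?y (s *\<^sub>R h))) (at t)"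
      by (rule has_derivative_compose[of "\<lambda>t. x + t *\<^sub>R h" "\<lambda>s. s *\<^sub>R h" _ _ F "F' ?y", OF _ deriv[OF y]])
        (auto intro!: derivative_eq_intros)
    then have "((\<lambda>t. v \<bullet> F (x + t *\<^sub>R h)) has_derivative (\<lambda>s. v \<bullet> F' ?y (s *\<^sub>R h))) (at t)"
      by (rule has_derivative_inner_right)
    moreover have "(\<lambda>s. v \<bullet> F' ?y (s *\<^sub>R h)) = (*) (v \<bullet> F' ?y h)"
      using linear_scale[OF has_derivative_linear[OF deriv[OF y]]] by (auto simp: fun_eq_iff)
    ultimately have "((\<lambda>t. v \<bullet> F (x + t *\<^sub>R h)) has_real_derivative v \<bullet> F' ?y h) (at t)"
      by (simp add: has_field_derivative_def)
    then have "(\<psi> has_real_derivative v \<bullet> F' ?y h - v \<bullet> F' x h - K * t) (at t)"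
      unfolding \<psi>_def by (auto intro!: derivative_eq_intros)
    moreover have "v \<bullet> (F' ?y h - F' x h) \<le> norm v * norm (F' ?y h - F' x h)"
      by (rule norm_cauchy_schwarz)
    moreover have "\<dots> \<le> norm v * (L * norm (?y - x) * norm h)"
      by (intro mult_left_mono lip y) simp
    moreover have "\<dots> = K * t"
      using t by (simp add: K_def power2_eq_square)
    ultimately show "\<exists>d. (\<psi> has_real_derivative d) (at t) \<and> d \<le> 0"
      by (intro exI[of _ "v \<bullet> F' ?y h - v \<bullet> F' x h - K * t"]) (simp add: inner_diff_right)
  qed simp
  then have "v \<bullet> v \<le> K / 2"
    by (simp add: \<psi>_def v_def inner_diff_right)
  then have "norm v * norm v \<le> norm v * (L / 2 * (norm h)\<^sup>2)"
    by (simp add: K_def power2_norm_eq_inner[symmetric] power2_eq_square mult.assoc)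
  \<comment> \<open>Needed when \<open>v = 0\<close>, where \<open>norm v\<close> cannot be
    cancelled; the sign comes from \<open>lip\<close> at the far endpoint.\<close>
  moreover have "0 \<le> L / 2 * (norm h)\<^sup>2"
  proof (cases "h = 0")
    case False
    have "0 \<le> L * norm h * norm h"
      using order_trans[OF norm_ge_zero lip[OF assms(3)]] by simp
    then show ?thesis by (simp add: power2_eq_square)
  qed simp
  ultimately show ?thesis
    unfolding v_def[symmetric] by (cases "v = 0") simp_all
qed

text \<open>The adjoint of the derivative, applied to 1, is its Riesz vector; uniqueness of the
  derivative makes it the only candidate for the \<open>THE\<close> in \<open>grad\<close>.\<close>

lemma grad_has_derivative:
  assumes "f differentiable (at x)"
  shows "(f has_derivative (\<lambda>h. h \<bullet> grad f x)) (at x)"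
proof -
  obtain D where D: "(f has_derivative D) (at x)"
    using assms by (auto simp: differentiable_def)
  define d where "d = adjoint D 1"
  have "D h = h \<bullet> d" for h
    unfolding d_def using adjoint_works[OF has_derivative_linear[OF D], of h 1] by simp
  then have *: "GDERIV f x :> d"
    using D unfolding gderiv_def by (metis (no_types, lifting) ext)
  moreover have "d' = d" if "GDERIV f x :> d'" for d'
    using has_derivative_unique[OF that[unfolded gderiv_def] *[unfolded gderiv_def]]
    by (metis vector_eq_ldot)
  ultimately have "grad f x = d"
    unfolding grad_def by (rule the_equality)
  then show ?thesis using * by (simp add: gderiv_def)
qed

text \<open>Gradients are the columns of \<open>nabla c x\<close>, so the Jacobian acts from the
  other side, as \<open>h v* nabla c x\<close>.\<close>

lemma nabla_has_derivative:
  assumes "c differentiable (at x)"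
  shows "(c has_derivative (\<lambda>h. h v* nabla c x)) (at x)"
proof -
  obtain D where D: "(c has_derivative D) (at x)"
    using assms by (auto simp: differentiable_def)
  have comp: "((\<lambda>y. c y $ j) has_derivative (\<lambda>h. h \<bullet> grad (\<lambda>y. c y $ j) x)) (at x)" for j
    using bounded_linear.has_derivative[OF bounded_linear_vec_nth D]
    by (intro grad_has_derivative) (auto simp: differentiable_def)
  have "h \<bullet> grad (\<lambda>y. c y $ j) x = (h v* nabla c x) $ j" for h j
    by (simp add: nabla_def vector_matrix_mult_def inner_vec_def mult.commute)
  then show ?thesis
    using comp
    by (subst has_derivative_componentwise_within) (auto simp: Basis_vec_def inner_axis)
qed

section \<open>Spectral norm bounds and the regularized linear system\<close>

lemma norm_matrix_vector_le_spectral: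
  "norm (A *v u) \<le> spectral_norm A * norm u" for A :: "real ^ 'm ^ 'n"
  unfolding spectral_norm_def by (rule onorm) simp

text \<open>The square of the left side is \<open>u \<bullet> (A *v (u v* A))\<close>;
  Cauchy-Schwarz and the bound for \<open>A\<close> leave one factor \<open>norm (u v* A)\<close> to
  cancel.\<close>

lemma norm_vector_matrix_le_spectral:
  "norm (u v* A) \<le> spectral_norm A * norm u" for A :: "real ^ 'm ^ 'n"
proof (cases "u v* A = 0")
  case True
  then show ?thesis
    \<comment> \<open>Any unit vector would do: it shows that \<open>spectral_norm A\<close> is
      nonnegative.\<close>
    using order_trans[OF norm_ge_zero norm_matrix_vector_le_spectral[of A "axis undefined 1"]] by simp
next
  case False
  have "norm (u v* A) * norm (u v* A) = u \<bullet> (A *v (u v* A))"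
    by (simp flip: dot_lmul_matrix power2_norm_eq_inner power2_eq_square)
  also have "\<dots> \<le> norm u * norm (A *v (u v* A))"
    by (rule norm_cauchy_schwarz)
  also have "\<dots> \<le> norm u * (spectral_norm A * norm (u v* A))"
    by (intro mult_left_mono norm_matrix_vector_le_spectral) simp
  finally show ?thesis using False by (simp add: mult.commute)
qed

lemma le_divide_if_mult_square_le:
  fixes K s t :: real
  assumes "K * s\<^sup>2 \<le> s * t" "0 < K" "0 \<le> s" "0 \<le> t"
  shows "s \<le> t / K"
proof (cases "s = 0")
  case False
  have "s * (K * s) \<le> s * t"
    using assms(1) by (simp add: power2_eq_square mult.left_commute)
  then show ?thesis
    using False assms by (simp add: pos_le_divide_eq mult.commute)
qed (use assms in simp)

lemma regularized_gram_apply: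
  "(\<beta> *\<^sub>R mat 1 + \<rho> *\<^sub>R (J ** transpose J)) *v p = \<beta> *\<^sub>R p + \<rho> *\<^sub>R (J *v (p v* J))"
  for J :: "real ^ 'm ^ 'n"
  by (simp add: matrix_vector_mult_add_rdistrib flip: scaleR_matrix_vector_assoc matrix_vector_mul_assoc)

text \<open>The two terms need different constants. Since \<open>J J^T\<close> may be singular,
  \<open>g\<close> is divided by \<beta> only; \<open>w\<close> is treated in the smaller space
  through \<open>T\<close>, that is \<beta> I + \<rho> J^T J, where injectivity of \<open>J\<close>
  adds \<rho> \<sigma>^2.\<close>

lemma regularized_gram_solution_bound:
  fixes J :: "real ^ 'm ^ 'n"
  assumes "\<beta> > 0" "\<rho> > 0" "\<sigma> > 0" "spectral_norm J \<le> M"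
    and inj: "\<And>u. norm (J *v u) \<ge> \<sigma> * norm u"
    and eq: "\<beta> *\<^sub>R p + \<rho> *\<^sub>R (J *v (p v* J)) = - g - J *v w"
  shows "norm p \<le> norm g / \<beta> + M * norm w / (\<beta> + \<rho> * \<sigma>\<^sup>2)"
proof -
  define T where "T u = \<beta> *\<^sub>R u + \<rho> *\<^sub>R ((J *v u) v* J)" for u
  have coercive: "(\<beta> + \<rho> * \<sigma>\<^sup>2) * (norm u)\<^sup>2 \<le> u \<bullet> T u" for u
  proof -
    have "u \<bullet> T u = \<beta> * (norm u)\<^sup>2 + \<rho> * (norm (J *v u))\<^sup>2"
      by (simp add: T_def inner_add_right power2_norm_eq_inner dot_lmul_matrix inner_commute[of u "_ v* _"])
    moreover have "(\<sigma> * norm u)\<^sup>2 \<le> (norm (J *v u))\<^sup>2"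
      using inj[of u] assms(3) by (intro power_mono) auto
    ultimately show ?thesis
      using mult_left_mono[of "(\<sigma> * norm u)\<^sup>2" "(norm (J *v u))\<^sup>2" \<rho>] assms(2)
      by (simp add: algebra_simps power_mult_distrib)
  qed
  have pos: "\<beta> + \<rho> * \<sigma>\<^sup>2 > 0"
    using assms by (simp add: add_pos_nonneg)
  have lin: "linear T"
    unfolding T_def
    by (rule linearI)
      (simp_all add: algebra_simps matrix_vector_mult_scaleR vector_scaleR_matrix_ac flip: transpose_matrix_vector)
  have "inj T"
    unfolding linear_injective_0[OF lin]
  proof (intro allI impI)
    fix u assume "T u = 0"
    then show "u = 0"
      using coercive[of u] pos by (simp add: mult_le_0_iff)
  qed
  then obtain u where u: "T u = - w"
    using linear_injective_imp_surjective[OF lin] by (metis surjD)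
  have "(\<beta> + \<rho> * \<sigma>\<^sup>2) * (norm u)\<^sup>2 \<le> norm u * norm w"
    using order_trans[OF coercive[of u] norm_cauchy_schwarz[of u "T u"]] u by simp
  then have u_le: "norm u \<le> norm w / (\<beta> + \<rho> * \<sigma>\<^sup>2)"
    by (intro le_divide_if_mult_square_le pos) simp_all
  \<comment> \<open>The part of the solution driven by \<open>J *v w\<close> is \<open>J *v u\<close>, by the push-through identity.\<close>
  define q where "q = p - J *v u"
  have "J *v T u = \<beta> *\<^sub>R (J *v u) + \<rho> *\<^sub>R (J *v ((J *v u) v* J))"
    by (simp add: T_def matrix_vector_right_distrib matrix_vector_mult_scaleR)
  then have "\<beta> *\<^sub>R (J *v u) + \<rho> *\<^sub>R (J *v ((J *v u) v* J)) = - (J *v w)"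
    by (simp add: u vec.neg)
  moreover have "\<beta> *\<^sub>R q + \<rho> *\<^sub>R (J *v (q v* J)) =
      (\<beta> *\<^sub>R p + \<rho> *\<^sub>R (J *v (p v* J))) - (\<beta> *\<^sub>R (J *v u) + \<rho> *\<^sub>R (J *v ((J *v u) v* J)))"
    by (simp add: q_def scaleR_diff_right vec.diff flip: transpose_matrix_vector)
  ultimately have q: "\<beta> *\<^sub>R q + \<rho> *\<^sub>R (J *v (q v* J)) = - g"
    using eq by simp
  have "\<beta> * (norm q)\<^sup>2 + \<rho> * (norm (q v* J))\<^sup>2 = q \<bullet> (- g)"
    unfolding q[symmetric] by (simp add: inner_add_right power2_norm_eq_inner dot_lmul_matrix)
  also have "\<dots> \<le> norm q * norm g"
    using norm_cauchy_schwarz[of q "- g"] by simp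
  finally have "\<beta> * (norm q)\<^sup>2 \<le> norm q * norm g"
    using assms(2) by (smt (verit) mult_nonneg_nonneg zero_le_power2)
  then have "norm q \<le> norm g / \<beta>"
    by (intro le_divide_if_mult_square_le assms(1)) simp_all
  moreover have "norm (J *v u) \<le> M * (norm w / (\<beta> + \<rho> * \<sigma>\<^sup>2))"
  proof -
    have "norm (J *v u) \<le> M * norm u"
      using norm_matrix_vector_le_spectral[of J u] assms(4) by (meson mult_right_mono norm_ge_zero order_trans)
    moreover have "0 \<le> M"
      using order_trans[OF norm_ge_zero norm_matrix_vector_le_spectral[of J "axis undefined 1"]] assms(4) by simp
    ultimately show ?thesis
      using mult_left_mono[OF u_le] by (meson order_trans)
  qed
  moreover have "norm p \<le> norm q + norm (J *v u)"
    unfolding q_def by (metis diff_add_cancel norm_triangle_ineq)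
  ultimately show ?thesis by simp
qed

section \<open>Invariants along a run of the algorithm\<close>

locale nr_lalm_run =
  fixes f :: "real ^ 'n \<Rightarrow> real" and c :: "real ^ 'n \<Rightarrow> real ^ 'm"
    and U :: "(real ^ 'n) set"
    and f_low G L\<^sub>f M L\<^sub>c \<sigma> \<beta> \<rho> \<Delta> \<Lambda> :: real
    and x p :: "nat \<Rightarrow> real ^ 'n" and l :: "nat \<Rightarrow> real ^ 'm"
    and N :: nat
  assumes regular: "regularity f c U f_low G L\<^sub>f M L\<^sub>c \<sigma>"
    and params: "parameter_conditions G L\<^sub>f M L\<^sub>c \<sigma> \<beta> \<rho> \<Delta> \<Lambda>"
    and init: "initial_conditions c \<rho> \<Lambda> (x 0) (l 0)"
    and iterates: "nr_lalm_iterates f c \<beta> \<rho> N x l p"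
    and segment: "\<And>k. k < N \<Longrightarrow> closed_segment (x k) (x (Suc k)) \<subseteq> U"
begin

lemma pos: "G > 0" "L\<^sub>f > 0" "M > 0" "L\<^sub>c > 0" "\<sigma> > 0" "\<beta> > 0" "\<rho> > 0" "\<Delta> > 0" "\<Lambda> > 0"
  using regular params by (auto simp: regularity_def parameter_conditions_def)

lemma in_U:
  assumes "k < N"
  shows "x k \<in> U" "x (Suc k) \<in> U"
  using segment[OF assms] by auto

lemma
  assumes "k < N"
  shows primal_step: "x (Suc k) = x k + p k"
    and dual_step: "l (Suc k) = l k + \<rho> *\<^sub>R c (x (Suc k))"
    and step_equation: "\<beta> *\<^sub>R p k + \<rho> *\<^sub>R (nabla c (x k) *v (p k v* nabla c (x k))) =
      - grad f (x k) - nabla c (x k) *v (l k + \<rho> *\<^sub>R c (x k))"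
  using iterates assms by (auto simp: nr_lalm_iterates_def nr_lalm_step_def regularized_gram_apply)

definition remainder :: "nat \<Rightarrow> real ^ 'm" where
  "remainder k = c (x (Suc k)) - c (x k) - p k v* nabla c (x k)"

lemma nabla_lipschitz:
  assumes "y \<in> U" "z \<in> U"
  shows "norm (h v* nabla c y - h v* nabla c z) \<le> L\<^sub>c * norm (y - z) * norm h"
    and "norm (nabla c y *v u - nabla c z *v u) \<le> L\<^sub>c * norm (y - z) * norm u"
proof -
  have "spectral_norm (nabla c y - nabla c z) \<le> L\<^sub>c * norm (y - z)"
    using regular assms by (simp add: regularity_def)
  then show "norm (h v* nabla c y - h v* nabla c z) \<le> L\<^sub>c * norm (y - z) * norm h"
    "norm (nabla c y *v u - nabla c z *v u) \<le> L\<^sub>c * norm (y - z) * norm u"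
    using norm_vector_matrix_le_spectral[of h "nabla c y - nabla c z"]
      norm_matrix_vector_le_spectral[of "nabla c y - nabla c z" u]
    unfolding vector_matrix_mult_diff_rdistrib matrix_vector_mult_diff_rdistrib
    by (meson mult_right_mono norm_ge_zero order_trans)+
qed

lemma nabla_le:
  assumes "y \<in> U"
  shows "norm (nabla c y *v u) \<le> M * norm u" and "norm (h v* nabla c y) \<le> M * norm h"
proof -
  have "spectral_norm (nabla c y) \<le> M"
    using regular assms by (simp add: regularity_def)
  then show "norm (nabla c y *v u) \<le> M * norm u" "norm (h v* nabla c y) \<le> M * norm h"
    using norm_matrix_vector_le_spectral[of "nabla c y" u] norm_vector_matrix_le_spectral[of h "nabla c y"]
    by (meson mult_right_mono norm_ge_zero order_trans)+
qed

lemma remainder_le: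
  assumes "k < N"
  shows "norm (remainder k) \<le> kappa_lin L\<^sub>c * (norm (p k))\<^sup>2"
proof -
  have "norm (c (x k + p k) - c (x k) - p k v* nabla c (x k)) \<le> L\<^sub>c / 2 * (norm (p k))\<^sup>2"
  proof (rule quadratic_remainder_bound)
    \<comment> \<open>The segment serves as convex set, since \<open>U\<close> is only assumed
      open.\<close>
    show "convex (closed_segment (x k) (x (Suc k)))" by simp
    fix y assume y: "y \<in> closed_segment (x k) (x (Suc k))"
    then have "y \<in> U" using segment[OF assms] by auto
    then show "(c has_derivative (\<lambda>h. h v* nabla c y)) (at y)"
      using regular by (intro nabla_has_derivative) (simp add: regularity_def)
    show "norm (p k v* nabla c y - p k v* nabla c (x k)) \<le> L\<^sub>c * norm (y - x k) * norm (p k)"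
      using nabla_lipschitz(1) \<open>y \<in> U\<close> in_U[OF assms] by blast
  qed (simp_all flip: primal_step[OF assms])
  then show ?thesis
    by (simp add: remainder_def kappa_lin_def primal_step[OF assms])
qed

lemma objective_le:
  assumes "k < N"
  shows "f (x (Suc k)) \<le> f (x k) + p k \<bullet> grad f (x k) + L\<^sub>f / 2 * (norm (p k))\<^sup>2"
proof -
  have "norm (f (x k + p k) - f (x k) - p k \<bullet> grad f (x k)) \<le> L\<^sub>f / 2 * (norm (p k))\<^sup>2"
  proof (rule quadratic_remainder_bound)
    show "convex (closed_segment (x k) (x (Suc k)))" by simp
    fix y assume y: "y \<in> closed_segment (x k) (x (Suc k))"
    then have "y \<in> U" using segment[OF assms] by auto
    then show "(f has_derivative (\<lambda>h. h \<bullet> grad f y)) (at y)"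
      using regular by (intro grad_has_derivative) (simp add: regularity_def)
    have "norm (p k \<bullet> grad f y - p k \<bullet> grad f (x k)) \<le> norm (p k) * norm (grad f y - grad f (x k))"
      using Cauchy_Schwarz_ineq2[of "p k" "grad f y - grad f (x k)"] by (simp add: inner_diff_right)
    also have "\<dots> \<le> norm (p k) * (L\<^sub>f * norm (y - x k))"
      using regular \<open>y \<in> U\<close> in_U[OF assms] by (intro mult_left_mono) (auto simp: regularity_def)
    finally show "norm (p k \<bullet> grad f y - p k \<bullet> grad f (x k)) \<le> L\<^sub>f * norm (y - x k) * norm (p k)"
      by (simp add: mult.commute)
  qed (simp_all flip: primal_step[OF assms])
  then show ?thesis
    unfolding primal_step[OF assms] real_norm_def by linarith
qed

text \<open>The new multiplier is the bracket of the step equation plus \<rho> times the linearized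
  increment and the remainder; the step equation eliminates all but the remainder.\<close>

lemma multiplier_equation:
  assumes "k < N"
  shows "nabla c (x k) *v l (Suc k) =
    \<rho> *\<^sub>R (nabla c (x k) *v remainder k) - grad f (x k) - \<beta> *\<^sub>R p k"
proof -
  have "l (Suc k) = (l k + \<rho> *\<^sub>R c (x k)) + \<rho> *\<^sub>R (p k v* nabla c (x k)) + \<rho> *\<^sub>R remainder k"
    by (simp add: dual_step[OF assms] remainder_def algebra_simps)
  then have "nabla c (x k) *v l (Suc k) = nabla c (x k) *v (l k + \<rho> *\<^sub>R c (x k)) +
      \<rho> *\<^sub>R (nabla c (x k) *v (p k v* nabla c (x k))) + \<rho> *\<^sub>R (nabla c (x k) *v remainder k)"
    by (simp add: matrix_vector_right_distrib matrix_vector_mult_scaleR)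
  then show ?thesis
    using step_equation[OF assms] by (simp add: algebra_simps)
qed

text \<open>One factor of the squared step is traded for \<Delta>, leaving a bound linear in
  \<open>norm (p k)\<close>, as in \<open>A_p\<close>.\<close>

lemma scaled_remainder_le:
  assumes "k < N" "norm (p k) \<le> \<Delta>"
  shows "norm (\<rho> *\<^sub>R (nabla c (x k) *v remainder k)) \<le> \<rho> * M * kappa_lin L\<^sub>c * \<Delta> * norm (p k)"
proof -
  have "norm (nabla c (x k) *v remainder k) \<le> M * norm (remainder k)"
    using nabla_le(1) in_U(1)[OF assms(1)] .
  also have "\<dots> \<le> M * (kappa_lin L\<^sub>c * (norm (p k))\<^sup>2)"
    using remainder_le[OF assms(1)] pos by (intro mult_left_mono) auto
  also have "\<dots> \<le> M * (kappa_lin L\<^sub>c * (\<Delta> * norm (p k)))"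
    using assms(2) pos unfolding power2_eq_square kappa_lin_def
    by (intro mult_left_mono mult_right_mono) auto
  finally show ?thesis
    using pos by (simp add: mult_left_mono mult.assoc)
qed

lemma multiplier_le:
  assumes "k < N" "norm (p k) \<le> \<Delta>"
  shows "norm (l (Suc k)) \<le> \<Lambda>"
proof -
  have triangle: "norm (a - b - d) \<le> norm a + norm b + norm d" for a b d :: "real ^ 'n"
    by norm
  have "\<sigma> * norm (l (Suc k)) \<le> norm (nabla c (x k) *v l (Suc k))"
    using regular in_U[OF assms(1)] by (simp add: regularity_def)
  also have "\<dots> \<le> norm (\<rho> *\<^sub>R (nabla c (x k) *v remainder k)) + norm (grad f (x k)) + norm (\<beta> *\<^sub>R p k)"
    unfolding multiplier_equation[OF assms(1)] by (rule triangle)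
  also have "\<dots> \<le> \<rho> * M * kappa_lin L\<^sub>c * \<Delta> * norm (p k) + G + \<beta> * norm (p k)"
    using scaled_remainder_le[OF assms] regular in_U[OF assms(1)] pos
    by (intro add_mono) (auto simp: regularity_def)
  also have "\<dots> \<le> \<rho> * M * kappa_lin L\<^sub>c * \<Delta> * \<Delta> + G + \<beta> * \<Delta>"
    using assms(2) pos by (intro add_mono mult_left_mono) (auto simp: kappa_lin_def)
  \<comment> \<open>The parameter condition on \<Lambda>, multiplied by \<sigma>.\<close>
  also have "\<dots> \<le> \<sigma> * \<Lambda>"
    using params pos by (simp add: parameter_conditions_def pos_divide_le_eq power2_eq_square algebra_simps)
  finally show ?thesis
    using pos by simp
qed

lemma step_le:
  assumes "k < N" "norm (l k) \<le> \<Lambda>" "\<rho> * norm (c (x k)) \<le> 2 * \<Lambda>"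
  shows "norm (p k) \<le> \<Delta>"
proof -
  have "norm (p k) \<le> norm (grad f (x k)) / \<beta> + M * norm (l k + \<rho> *\<^sub>R c (x k)) / (\<beta> + \<rho> * \<sigma>\<^sup>2)"
    using regular in_U[OF assms(1)] pos
    by (intro regularized_gram_solution_bound[OF _ _ _ _ _ step_equation[OF assms(1)]])
      (auto simp: regularity_def)
  moreover have "norm (grad f (x k)) / \<beta> \<le> G / \<beta>"
    using regular in_U[OF assms(1)] pos by (simp add: regularity_def divide_right_mono)
  moreover have "M * norm (l k + \<rho> *\<^sub>R c (x k)) / (\<beta> + \<rho> * \<sigma>\<^sup>2) \<le> 3 * M * \<Lambda> / (\<beta> + \<rho> * \<sigma>\<^sup>2)"
  proof (rule divide_right_mono)
    have "norm (l k + \<rho> *\<^sub>R c (x k)) \<le> 3 * \<Lambda>"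
      using assms pos norm_triangle_ineq[of "l k" "\<rho> *\<^sub>R c (x k)"] by simp
    then show "M * norm (l k + \<rho> *\<^sub>R c (x k)) \<le> 3 * M * \<Lambda>"
      using pos by (simp add: mult.assoc mult.left_commute[of 3])
  qed (use pos in simp)
  ultimately show ?thesis
    using params by (simp add: parameter_conditions_def)
qed

text \<open>The factor 2 arises because \<rho> times the new constraint value is a difference of two
  multipliers, each bounded by \<Lambda>.\<close>

lemma state_bounds:
  "k \<le> N \<Longrightarrow> norm (l k) \<le> \<Lambda> \<and> \<rho> * norm (c (x k)) \<le> 2 * \<Lambda>"
proof (induction k)
  case 0
  then show ?case
    using init pos by (simp add: initial_conditions_def)
next
  case (Suc k)
  then have k: "k < N" and *: "norm (l k) \<le> \<Lambda>" "\<rho> * norm (c (x k)) \<le> 2 * \<Lambda>" by auto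
  have "norm (l (Suc k)) \<le> \<Lambda>"
    using multiplier_le[OF k step_le[OF k *]] .
  moreover have "\<rho> * norm (c (x (Suc k))) = norm (l (Suc k) - l k)"
    using dual_step[OF k] pos by simp
  ultimately show ?case
    using *(1) norm_triangle_ineq4[of "l (Suc k)" "l k"] by simp
qed

lemma step_norm_le: "k < N \<Longrightarrow> norm (p k) \<le> \<Delta>"
  using step_le state_bounds by simp

lemma constraint_norm_le:
  assumes "k < N"
  shows "norm (l k) + \<rho> * norm (c (x k)) \<le> 3 * \<Lambda>"
  using state_bounds[of k] assms by simp

section \<open>Descent of the augmented Lagrangian and of the potential\<close>

lemma primal_descent:
  assumes k: "k < N"
  shows "aug_lagrangian f c \<rho> (x (Suc k)) (l k) \<le>
    aug_lagrangian f c \<rho> (x k) (l k) - 5 * \<beta> / 8 * (norm (p k))\<^sup>2"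
proof -
  define s where "s = (norm (p k))\<^sup>2"
  define a where "a = p k v* nabla c (x k)"
  define r where "r = remainder k"
  define \<kappa> where "\<kappa> = kappa_lin L\<^sub>c"
  have c_next: "c (x (Suc k)) = c (x k) + a + r"
    by (simp add: a_def r_def remainder_def)
  have r_le: "norm r \<le> \<kappa> * s"
    using remainder_le[OF k] by (simp add: r_def s_def \<kappa>_def)
  have s_le: "s \<le> \<Delta>\<^sup>2"
    unfolding s_def using step_norm_le[OF k] by (intro power_mono) auto
  have p_inner: "p k \<bullet> (nabla c (x k) *v u) = a \<bullet> u" for u
    by (simp add: a_def dot_lmul_matrix)
  have "p k \<bullet> (\<beta> *\<^sub>R p k + \<rho> *\<^sub>R (nabla c (x k) *v a)) =
      p k \<bullet> (- grad f (x k) - nabla c (x k) *v (l k + \<rho> *\<^sub>R c (x k)))"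
    using step_equation[OF k] by (simp add: a_def)
  \<comment> \<open>The step equation tested with \<open>p k\<close> itself.\<close>
  then have model: "p k \<bullet> grad f (x k) + l k \<bullet> a + \<rho> * (c (x k) \<bullet> a) = - \<beta> * s - \<rho> * (a \<bullet> a)"
    by (simp add: s_def power2_norm_eq_inner inner_add_right inner_diff_right p_inner
        inner_commute[of "l k" a] inner_commute[of "c (x k)" a] matrix_vector_right_distrib
        matrix_vector_mult_scaleR)
  have lin: "l k \<bullet> r + \<rho> * ((c (x k) + a) \<bullet> r) \<le> (3 * \<Lambda> + \<rho> * M * \<Delta>) * (\<kappa> * s)"
  proof -
    have "norm a \<le> M * \<Delta>"
      using nabla_le(2)[OF in_U(1)[OF k], of "p k"] step_norm_le[OF k] pos
      unfolding a_def by (meson mult_left_mono less_imp_le order_trans)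
    then have "\<rho> * norm (c (x k) + a) \<le> \<rho> * (norm (c (x k)) + M * \<Delta>)"
      using norm_triangle_ineq[of "c (x k)" a] pos by (intro mult_left_mono) auto
    moreover have "norm (l k + \<rho> *\<^sub>R (c (x k) + a)) \<le> norm (l k) + \<rho> * norm (c (x k) + a)"
      using norm_triangle_ineq[of "l k" "\<rho> *\<^sub>R (c (x k) + a)"] pos by simp
    ultimately have "norm (l k + \<rho> *\<^sub>R (c (x k) + a)) \<le> 3 * \<Lambda> + \<rho> * M * \<Delta>"
      using constraint_norm_le[OF k] by (simp add: distrib_left mult.assoc)
    then have "norm (l k + \<rho> *\<^sub>R (c (x k) + a)) * norm r \<le> (3 * \<Lambda> + \<rho> * M * \<Delta>) * (\<kappa> * s)"
      using r_le pos by (intro mult_mono) auto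
    then show ?thesis
      using norm_cauchy_schwarz[of "l k + \<rho> *\<^sub>R (c (x k) + a)" r] by (simp add: inner_add_left)
  qed
  have quad: "\<rho> / 2 * (r \<bullet> r) \<le> \<rho> / 2 * \<kappa>\<^sup>2 * \<Delta>\<^sup>2 * s"
  proof -
    have "r \<bullet> r \<le> (\<kappa> * s)\<^sup>2"
      using power_mono[OF r_le, of 2] by (simp add: power2_norm_eq_inner)
    also have "\<dots> \<le> \<kappa>\<^sup>2 * (\<Delta>\<^sup>2 * s)"
      unfolding power_mult_distrib power2_eq_square[of s]
      using s_le by (intro mult_left_mono mult_right_mono) (auto simp: s_def)
    finally show ?thesis using pos by simp
  qed
  have "aug_lagrangian f c \<rho> (x (Suc k)) (l k) - aug_lagrangian f c \<rho> (x k) (l k) =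
      (f (x (Suc k)) - f (x k)) + l k \<bullet> a + \<rho> * (c (x k) \<bullet> a) + \<rho> / 2 * (a \<bullet> a)
      + (l k \<bullet> r + \<rho> * ((c (x k) + a) \<bullet> r)) + \<rho> / 2 * (r \<bullet> r)"
    by (simp add: aug_lagrangian_def c_next power2_norm_eq_inner inner_add_left inner_add_right
        inner_commute[of r a] inner_commute[of r "c (x k)"] inner_commute[of a "c (x k)"] algebra_simps)
  \<comment> \<open>Half of the gain \<open>\<rho> * (a \<bullet> a)\<close> from
    \<open>model\<close> pays for the quadratic term in \<open>a\<close>. The errors from
    \<open>f\<close>, \<open>lin\<close> and \<open>quad\<close> add up to
    \<open>C_mod\<close>.\<close>
  also have "\<dots> \<le> - \<beta> * s - \<rho> / 2 * (a \<bullet> a) + C_mod L\<^sub>f M L\<^sub>c \<rho> \<Delta> \<Lambda> * s"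
    using objective_le[OF k] model lin quad
    unfolding C_mod_def \<kappa>_def[symmetric] s_def[symmetric] by (simp add: algebra_simps)
  also have "\<dots> \<le> - \<beta> * s + 3 * \<beta> / 8 * s"
  proof -
    have "C_mod L\<^sub>f M L\<^sub>c \<rho> \<Delta> \<Lambda> * s \<le> 3 * \<beta> / 8 * s"
      using params by (intro mult_right_mono) (auto simp: parameter_conditions_def s_def)
    moreover have "0 \<le> \<rho> / 2 * (a \<bullet> a)" using pos by simp
    ultimately show ?thesis by linarith
  qed
  finally show ?thesis by (simp add: s_def algebra_simps)
qed

text \<open>The augmented Lagrangian is affine in the multiplier with slope
  \<open>c (x (Suc k))\<close>, which is the multiplier increment divided by \<rho>.\<close>

lemma dual_ascent:
  assumes k: "k < N"
  shows "aug_lagrangian f c \<rho> (x (Suc k)) (l (Suc k)) =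
    aug_lagrangian f c \<rho> (x (Suc k)) (l k) + (norm (l (Suc k) - l k))\<^sup>2 / \<rho>"
proof -
  have "\<rho> *\<^sub>R c (x (Suc k)) = l (Suc k) - l k"
    using dual_step[OF k] by simp
  then have "(norm (l (Suc k) - l k))\<^sup>2 / \<rho> = \<rho> * (c (x (Suc k)) \<bullet> c (x (Suc k)))"
    using pos by (simp add: power2_eq_square flip: \<open>\<rho> *\<^sub>R _ = _\<close> power2_norm_eq_inner)
  then show ?thesis
    by (simp add: aug_lagrangian_def dual_step[OF k] inner_add_left)
qed

lemma multiplier_diff_le:
  assumes k: "Suc k < N"
  shows "(norm (l (Suc (Suc k)) - l (Suc k)))\<^sup>2 \<le>
    C_lambda_p L\<^sub>f M L\<^sub>c \<sigma> \<beta> \<rho> \<Delta> \<Lambda> / 2 * ((norm (p (Suc k)))\<^sup>2 + (norm (p k))\<^sup>2)"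
proof -
  let ?A = "A_p M L\<^sub>c \<beta> \<rho> \<Delta>" and ?B = "B_p L\<^sub>f M L\<^sub>c \<beta> \<rho> \<Delta> \<Lambda>"
  define d where "d = norm (l (Suc (Suc k)) - l (Suc k))"
  define e where "e j = \<rho> *\<^sub>R (nabla c (x j) *v remainder j)" for j
  define m where "m = max (?A\<^sup>2) (?B\<^sup>2)"
  have k': "k < N" using k by simp
  have p: "x (Suc k) - x k = p k"
    using primal_step[OF k'] by simp
  have e_le: "norm (e j) \<le> \<rho> * M * kappa_lin L\<^sub>c * \<Delta> * norm (p j)" if "j < N" for j
    unfolding e_def using scaled_remainder_le[OF that step_norm_le[OF that]] .
  have g_le: "norm (grad f (x (Suc k)) - grad f (x k)) \<le> L\<^sub>f * norm (p k)"
    using regular in_U[OF k'] by (simp add: regularity_def flip: p)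
  have "norm (nabla c (x (Suc k)) *v l (Suc k) - nabla c (x k) *v l (Suc k)) \<le>
      L\<^sub>c * norm (p k) * norm (l (Suc k))"
    using nabla_lipschitz(2)[OF in_U(2,1)[OF k']] by (simp add: p)
  also have "\<dots> \<le> L\<^sub>c * norm (p k) * \<Lambda>"
    using state_bounds[of "Suc k"] k pos by (intro mult_left_mono) auto
  finally have J_le: "norm (nabla c (x (Suc k)) *v l (Suc k) - nabla c (x k) *v l (Suc k)) \<le>
      L\<^sub>c * norm (p k) * \<Lambda>" .
  have triangle: "norm (a1 - a2 - a3 - a4 + a5 - a6) \<le>
      norm a1 + norm a2 + norm a3 + norm a4 + norm a5 + norm a6" for a1 a2 a3 a4 a5 a6 :: "real ^ 'n"
    by norm
  have "\<sigma> * d \<le> norm (nabla c (x (Suc k)) *v (l (Suc (Suc k)) - l (Suc k)))"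
    unfolding d_def using regular in_U(2)[OF k'] by (simp add: regularity_def)
  \<comment> \<open>The two multiplier equations involve different matrices; the last term corrects
    for this and contributes \<open>L\<^sub>c * \<Lambda>\<close> to \<open>B_p\<close>.\<close>
  also have "nabla c (x (Suc k)) *v (l (Suc (Suc k)) - l (Suc k)) =
      e (Suc k) - e k - (grad f (x (Suc k)) - grad f (x k)) - \<beta> *\<^sub>R p (Suc k) + \<beta> *\<^sub>R p k
      - (nabla c (x (Suc k)) *v l (Suc k) - nabla c (x k) *v l (Suc k))"
    using multiplier_equation[OF k] multiplier_equation[OF k']
    by (simp add: vec.diff e_def)
  also have "norm \<dots> \<le> norm (e (Suc k)) + norm (e k) + norm (grad f (x (Suc k)) - grad f (x k))
      + norm (\<beta> *\<^sub>R p (Suc k)) + norm (\<beta> *\<^sub>R p k)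
      + norm (nabla c (x (Suc k)) *v l (Suc k) - nabla c (x k) *v l (Suc k))"
    by (rule triangle)
  also have "\<dots> \<le> ?A * norm (p (Suc k)) + ?B * norm (p k)"
    using e_le[OF k] e_le[OF k'] g_le J_le pos
    by (simp add: A_p_def B_p_def algebra_simps)
  finally have "(\<sigma> * d)\<^sup>2 \<le> (?A * norm (p (Suc k)) + ?B * norm (p k))\<^sup>2"
    using pos by (intro power_mono) (auto simp: d_def)
  also have "\<dots> \<le> 2 * (?A\<^sup>2 * (norm (p (Suc k)))\<^sup>2) + 2 * (?B\<^sup>2 * (norm (p k))\<^sup>2)"
    using sum_squares_bound[of "?A * norm (p (Suc k))" "?B * norm (p k)"]
    by (simp add: power2_sum flip: power_mult_distrib)
  also have "\<dots> \<le> 2 * (m * (norm (p (Suc k)))\<^sup>2) + 2 * (m * (norm (p k))\<^sup>2)"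
    by (intro add_mono mult_left_mono mult_right_mono) (auto simp: m_def)
  \<comment> \<open>The factor \<open>2 * m\<close> over \<sigma>^2 is half of
    \<open>C_lambda_p\<close>.\<close>
  finally have "d\<^sup>2 \<le> 2 * m * ((norm (p (Suc k)))\<^sup>2 + (norm (p k))\<^sup>2) / \<sigma>\<^sup>2"
    using pos by (simp add: pos_le_divide_eq power_mult_distrib algebra_simps)
  then show ?thesis
    by (simp add: C_lambda_p_def d_def m_def)
qed

text \<open>With \<open>K \<le> \<beta> / 8\<close>, the coefficient of \<open>s\<close> is at most
  -5/8 \<beta> + 3/2 K, hence at most -7/16 \<beta>, while that of \<open>t\<close> is -K/2.
  Indexing by \<open>Suc k\<close> ensures that a previous step exists.\<close>

lemma potential_descent:
  assumes k: "Suc k < N"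
  defines "\<Phi> \<equiv> potential f c \<rho> (C_lambda_p L\<^sub>f M L\<^sub>c \<sigma> \<beta> \<rho> \<Delta> \<Lambda>) x l p"
  shows "\<Phi> (Suc (Suc k)) \<le> \<Phi> (Suc k) - \<beta> / 4 * (norm (p (Suc k)))\<^sup>2"
proof -
  define K where "K = C_lambda_p L\<^sub>f M L\<^sub>c \<sigma> \<beta> \<rho> \<Delta> \<Lambda> / \<rho>"
  define s where "s = (norm (p (Suc k)))\<^sup>2"
  define t where "t = (norm (p k))\<^sup>2"
  have "K \<le> \<beta> / 8"
    using params pos by (simp add: K_def parameter_conditions_def field_simps)
  then have "K * s \<le> \<beta> / 8 * s"
    by (intro mult_right_mono) (auto simp: s_def)
  moreover have "(norm (l (Suc (Suc k)) - l (Suc k)))\<^sup>2 / \<rho> \<le> K / 2 * (s + t)"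
    using divide_right_mono[OF multiplier_diff_le[OF k], of \<rho>] pos by (simp add: K_def s_def t_def)
  moreover have "0 \<le> K * t" "0 \<le> \<beta> * s"
    using pos by (auto simp: K_def C_lambda_p_def t_def s_def le_max_iff_disj)
  ultimately show ?thesis
    using primal_descent[OF k] dual_ascent[OF k]
    unfolding \<Phi>_def potential_def by (simp add: K_def[symmetric] s_def[symmetric] t_def[symmetric] algebra_simps)
qed

text \<open>After completing the square, the only negative contribution besides \<open>f\<close> is
  the squared multiplier norm over 2 \<rho>, controlled by \<open>state_bounds\<close>.\<close>

lemma potential_lower_bound:
  assumes "k < N"
  shows "f_low - \<Lambda>\<^sup>2 / (2 * \<rho>) \<le> potential f c \<rho> (C_lambda_p L\<^sub>f M L\<^sub>c \<sigma> \<beta> \<rho> \<Delta> \<Lambda>) x l p (Suc k)"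
proof -
  let ?x = "x (Suc k)" and ?l = "l (Suc k)"
  have "f_low \<le> f ?x"
    using regular in_U[OF assms] by (simp add: regularity_def)
  moreover have "(norm ?l)\<^sup>2 / (2 * \<rho>) \<le> \<Lambda>\<^sup>2 / (2 * \<rho>)"
    using state_bounds[of "Suc k"] assms pos by (intro divide_right_mono power_mono) auto
  moreover have "aug_lagrangian f c \<rho> ?x ?l =
      f ?x + (norm (?l + \<rho> *\<^sub>R c ?x))\<^sup>2 / (2 * \<rho>) - (norm ?l)\<^sup>2 / (2 * \<rho>)"
    using pos by (simp add: aug_lagrangian_def power2_norm_eq_inner inner_add_left inner_add_right
        inner_commute[of "c ?x" ?l] field_simps)
  moreover have "0 \<le> (norm (?l + \<rho> *\<^sub>R c ?x))\<^sup>2 / (2 * \<rho>)"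
    using pos by simp
  moreover have "0 \<le> C_lambda_p L\<^sub>f M L\<^sub>c \<sigma> \<beta> \<rho> \<Delta> \<Lambda> / \<rho> * (norm (p k))\<^sup>2"
    using pos by (simp add: C_lambda_p_def le_max_iff_disj)
  ultimately show ?thesis
    unfolding potential_def by simp
qed

end

theorem theorem2p9:
  fixes f :: "real ^ 'n \<Rightarrow> real" and c :: "real ^ 'n \<Rightarrow> real ^ 'm"
    and U :: "(real ^ 'n) set"
    and f_low G L\<^sub>f M L\<^sub>c \<sigma> \<beta> \<rho> \<Delta> \<Lambda> :: real
    and x p :: "nat \<Rightarrow> real ^ 'n" and l :: "nat \<Rightarrow> real ^ 'm"
    and N :: nat
  defines "\<Phi> \<equiv> potential f c \<rho> (C_lambda_p L\<^sub>f M L\<^sub>c \<sigma> \<beta> \<rho> \<Delta> \<Lambda>) x l p"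
  assumes "regularity f c U f_low G L\<^sub>f M L\<^sub>c \<sigma>"
    and "parameter_conditions G L\<^sub>f M L\<^sub>c \<sigma> \<beta> \<rho> \<Delta> \<Lambda>"
    and "initial_conditions c \<rho> \<Lambda> (x 0) (l 0)"
    and "N \<ge> 2"
    and "nr_lalm_iterates f c \<beta> \<rho> N x l p"
    and "\<forall>k \<le> N - 1. closed_segment (x k) (x (k + 1)) \<subseteq> U"
  shows "(\<forall>k. 1 \<le> k \<and> k \<le> N - 1 \<longrightarrow> \<Phi> (k + 1) \<le> \<Phi> k - \<beta> / 4 * (norm (p k))\<^sup>2) \<and>
         (\<forall>k. 1 \<le> k \<and> k \<le> N \<longrightarrow> \<Phi> k \<ge> f_low - \<Lambda>\<^sup>2 / (2 * \<rho>))"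
proof -
  interpret nr_lalm_run f c U f_low G L\<^sub>f M L\<^sub>c \<sigma> \<beta> \<rho> \<Delta> \<Lambda> x p l N
    using assms by unfold_locales auto
  have "\<Phi> (k + 1) \<le> \<Phi> k - \<beta> / 4 * (norm (p k))\<^sup>2" if "1 \<le> k" "k \<le> N - 1" for k
    using potential_descent[of "k - 1"] that \<open>N \<ge> 2\<close> by (simp add: \<Phi>_def)
  moreover have "\<Phi> k \<ge> f_low - \<Lambda>\<^sup>2 / (2 * \<rho>)" if "1 \<le> k" "k \<le> N" for k
    using potential_lower_bound[of "k - 1"] that by (simp add: \<Phi>_def)
  ultimately show ?thesis by blast
qed

end
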